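(* Let $(X,d)$ be a metric space with $|X|\geq 2$. Then $(X,d)$ is totally bounded and ultrametric if and only if for every $r\in(0,\operatorname{diam} X]$ there is an integer $k=k(r)$ such that the graph $G_{X,d}^{r}$ is complete $k$-partite.
   Context: Graphs are simple: a graph $G=(V,E)$ consists of a nonempty set $V=V(G)$ of arbitrary cardinality and a set $E=E(G)$ of unordered pairs of distinct points of $V$. For a cardinal number $k\geq 2$, $G$ is complete $k$-partite if $V(G)$ can be partitioned into $k$ nonempty disjoint subsets (parts) such that no edge has both ends in the same part and any two vertices in different parts are adjacent. (In particular $k\ge 2$ always, so a graph without edges is not complete $k$-partite.) For a metric space $(X,d)$, $\operatorname{diam} X=\sup\{d(x,y):x,y\in X\}\in[0,\infty]$; if $\operatorname{diam} X=\infty$, then $(0,\operatorname{diam}X]=(0,\infty]$ includes $\infty$. For $r\in(0,\infty]$, $G_{X,d}^{r}$ is the graph with vertex set $X$ in which, for distinct $u,v\in X$, $\{u,v\}$ is an edge iff $d(u,v)\geq r$ (so $G^{\infty}_{X,d}$ has no edges). A metric space is ultrametric if $d(x,y)\leq\max\{d(x,z),d(z,y)\}$ for all $x,y,z\in X$. It is totally bounded if for every $r>0$ there are finitely many open balls $B_r(x_i)=\{x\in X: d(x_i,x)<r\}$, $x_i \in X$, of radius $r$ covering $X$. *)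

theory Defs
  imports "HOL-Analysis.Analysis" "HOL-Library.Disjoint_Sets"
begin

text \<open>A graph is a pair of a vertex set of arbitrary cardinality and a set of
  two-element sets of vertices.\<close>

type_synonym 'a ugraph = "'a set \<times> 'a set set"

abbreviation verts :: "'a ugraph \<Rightarrow> 'a set" where
  "verts G \<equiv> fst G"

abbreviation edges :: "'a ugraph \<Rightarrow> 'a set set" where
  "edges G \<equiv> snd G"

definition simple_graph :: "'a ugraph \<Rightarrow> bool" where
  "simple_graph G \<longleftrightarrow> verts G \<noteq> {} \<and>
     edges G \<subseteq> {{u, v} |u v. u \<in> verts G \<and> v \<in> verts G \<and> u \<noteq> v}"

text \<open>Only finite \<open>k\<close> is covered. Infinite partitions are excluded, because
  \<open>card\<close> is 0 on infinite sets and \<open>k \<ge> 2\<close>; nonemptiness of the parts is contained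
  in \<^const>\<open>partition_on\<close>.\<close>

definition complete_k_partite :: "nat \<Rightarrow> 'a ugraph \<Rightarrow> bool" where
  "complete_k_partite k G \<longleftrightarrow> simple_graph G \<and> k \<ge> 2 \<and>
     (\<exists>P. partition_on (verts G) P \<and> card P = k \<and>
        (\<forall>A\<in>P. \<forall>u\<in>A. \<forall>v\<in>A. {u, v} \<notin> edges G) \<and>
        (\<forall>A\<in>P. \<forall>B\<in>P. A \<noteq> B \<longrightarrow> (\<forall>u\<in>A. \<forall>v\<in>B. {u, v} \<in> edges G)))"

text \<open>The real-valued library constant \<^const>\<open>diameter\<close> is unspecified on unbounded sets,
  so the diameter is taken as an extended real here.\<close>

definition ediam :: "'a set \<Rightarrow> ('a \<Rightarrow> 'a \<Rightarrow> real) \<Rightarrow> ereal" where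
  "ediam X d = (SUP (x, y)\<in>X \<times> X. ereal (d x y))"

definition threshold_graph :: "'a set \<Rightarrow> ('a \<Rightarrow> 'a \<Rightarrow> real) \<Rightarrow> ereal \<Rightarrow> 'a ugraph" where
  "threshold_graph X d r =
     (X, {{u, v} |u v. u \<in> X \<and> v \<in> X \<and> u \<noteq> v \<and> ereal (d u v) \<ge> r})"

definition ultrametric_on :: "'a set \<Rightarrow> ('a \<Rightarrow> 'a \<Rightarrow> real) \<Rightarrow> bool" where
  "ultrametric_on X d \<longleftrightarrow> (\<forall>x\<in>X. \<forall>y\<in>X. \<forall>z\<in>X. d x y \<le> max (d x z) (d z y))"

lemma simple_graph_threshold_graph: "X \<noteq> {} \<Longrightarrow> simple_graph (threshold_graph X d r)"
  by (auto simp: simple_graph_def threshold_graph_def)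

end

theory Submission
  imports Defs
begin

text \<open>In an ultrametric space the open balls of a fixed radius \<open>r\<close> are the classes of the
  relation \<open>d x y < r\<close>, so they are the parts of the threshold graph; total boundedness says that
  there are finitely many of them. There are at least two because some distance is at least \<open>r\<close>,
  even when \<open>r\<close> is the diameter: the centres of a finite cover by balls of radius below \<open>r\<close> realize
  all larger distances. Conversely, a violation of the ultrametric inequality at \<open>x, y, z\<close> makes
  non-adjacency at threshold \<open>d x y\<close> intransitive, and representatives of the parts at threshold
  \<open>r\<close> are the centres of a finite cover by balls of radius \<open>r\<close>.\<close>

context Metric_space
begin

lemma edge_threshold_graph_iff:
  "{u, v} \<in> edges (threshold_graph M d r) \<longleftrightarrow>
     u \<in> M \<and> v \<in> M \<and> u \<noteq> v \<and> r \<le> ereal (d u v)"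
  by (auto simp: threshold_graph_def doubleton_eq_iff commute)

lemma dist_le_ediam: "x \<in> M \<Longrightarrow> y \<in> M \<Longrightarrow> ereal (d x y) \<le> ediam M d"
  unfolding ediam_def by (rule SUP_upper2[where i = "(x, y)"]) auto

text \<open>Every point of an ultrametric ball is a centre of it. One inclusion suffices, since
  \<open>y \<in> mball x r\<close> gives \<open>x \<in> mball y r\<close> by symmetry.\<close>

lemma ultrametric_mball_eq:
  assumes "ultrametric_on M d" "y \<in> mball x r"
  shows "mball y r = mball x r"
proof -
  have "mball y r \<subseteq> mball x r" if "y \<in> mball x r" for x y
  proof
    fix z assume "z \<in> mball y r"
    with that have "x \<in> M" "y \<in> M" "z \<in> M" "d x y < r" "d y z < r" by auto
    moreover from this have "d x z \<le> max (d x y) (d y z)"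
      using assms(1) by (simp add: ultrametric_on_def)
    ultimately show "z \<in> mball x r" by auto
  qed
  moreover have "x \<in> mball y r" using assms(2) by (auto simp: commute)
  ultimately show ?thesis using assms(2) by blast
qed

lemma ultrametric_ediam_attained:
  assumes "mtotally_bounded M" "ultrametric_on M d" "0 < r" "r \<le> ediam M d"
  obtains x y where "x \<in> M" "y \<in> M" "r \<le> ereal (d x y)"
proof (rule ccontr)
  assume "\<not> thesis"
  with that have lt: "ereal (d x y) < r" if "x \<in> M" "y \<in> M" for x y
    using \<open>x \<in> M\<close> \<open>y \<in> M\<close> not_le by blast
  \<comment> \<open>A real \<open>e\<close> exists even for \<open>r = \<infinity>\<close>, so that
    case needs no separate treatment.\<close>
  obtain e where e: "0 < ereal e" "ereal e < r"
    using ereal_dense2[OF assms(3)] by auto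
  obtain K where K: "finite K" "K \<subseteq> M" "M \<subseteq> (\<Union>x\<in>K. mball x e)"
    using assms(1)[unfolded mtotally_bounded_def, rule_format, of e] e(1) by auto
  define m where "m = Max (insert e ((\<lambda>(x, y). d x y) ` (K \<times> K)))"
  have fin: "finite (insert e ((\<lambda>(x, y). d x y) ` (K \<times> K)))"
    using K(1) by simp
  have m_ge: "e \<le> m" "\<And>x y. x \<in> K \<Longrightarrow> y \<in> K \<Longrightarrow> d x y \<le> m"
    unfolding m_def by (rule Max_ge[OF fin]; force)+
  \<comment> \<open>As a maximum over a finite set, \<open>m\<close> is \<open>e\<close> itself or a
    distance between two centres, and each of these lies strictly below \<open>r\<close>.\<close>
  have "m \<in> insert e ((\<lambda>(x, y). d x y) ` (K \<times> K))"
    unfolding m_def using fin by (intro Max_in) auto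
  then have "ereal m < r" using e lt K(2) by auto
  moreover have "ediam M d \<le> ereal m"
    unfolding ediam_def
  proof (rule SUP_least, clarify)
    fix x y assume xy: "x \<in> M" "y \<in> M"
    obtain a b where "a \<in> K" "b \<in> K" "x \<in> mball a e" "y \<in> mball b e"
      using K(3) xy by blast
    then have ab: "a \<in> K" "b \<in> K" "d a x < e" "d b y < e" by auto
    have M: "a \<in> M" "b \<in> M" using ab K(2) by auto
    \<comment> \<open>Passing through the centres \<open>a\<close> and \<open>b\<close> costs at
      most \<open>e\<close>, so \<open>m\<close> bounds all distances.\<close>
    have "d x y \<le> max (d x a) (d a y)" "d a y \<le> max (d a b) (d b y)"
      using assms(2) xy M unfolding ultrametric_on_def by blast+
    moreover have "d a b \<le> m" using m_ge(2) ab by blast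
    moreover have "d x a < e" using ab(3) commute by metis
    ultimately show "ereal (d x y) \<le> ereal m"
      using ab(4) m_ge(1) by auto
  qed
  ultimately show False using assms(4) by simp
qed

lemma complete_k_partite_threshold_graph:
  assumes tb: "mtotally_bounded M" and um: "ultrametric_on M d"
    and r: "0 < r" "r \<le> ediam M d"
  shows "\<exists>k. complete_k_partite k (threshold_graph M d r)"
proof -
  obtain x y where xy: "x \<in> M" "y \<in> M" "r \<le> ereal (d x y)"
    using ultrametric_ediam_attained[OF assms] .
  \<comment> \<open>Lying below the real number \<open>d x y\<close>, the threshold \<open>r\<close>
    is finite.\<close>
  then obtain s where s: "r = ereal s" "0 < s"
    using r(1) by (cases r) auto
  define P where "P = (\<lambda>x. mball x s) ` M"
  obtain K where K: "finite K" "K \<subseteq> M" "M \<subseteq> (\<Union>x\<in>K. mball x s)"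
    using tb[unfolded mtotally_bounded_def, rule_format, of s] s(2) by auto
  \<comment> \<open>Any point of a part serves as its centre, so lying in the same part means having
    distance below \<open>s\<close>.\<close>
  have eq: "A = mball u s" if "A \<in> P" "u \<in> A" for A u
    using that ultrametric_mball_eq[OF um] unfolding P_def by fast
  have part: "partition_on M P"
  proof (rule partition_onI)
    show "\<Union> P = M" using s(2) unfolding P_def by auto
    show "disjnt A B" if "A \<in> P" "B \<in> P" "A \<noteq> B" for A B
      using that eq unfolding disjnt_iff by blast
    show "{} \<notin> P" using s(2) unfolding P_def by auto
  qed
  have "P \<subseteq> (\<lambda>x. mball x s) ` K"
  proof
    fix A assume "A \<in> P"
    then obtain u where u: "u \<in> M" "A = mball u s" unfolding P_def by blast
    then obtain c where "c \<in> K" "u \<in> mball c s" using K(3) by blast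
    then show "A \<in> (\<lambda>x. mball x s) ` K"
      using ultrametric_mball_eq[OF um] u(2) by blast
  qed
  then have fin: "finite P" using K(1) finite_surj by blast
  have "y \<in> mball y s" "y \<notin> mball x s" using xy s by auto
  then have "mball x s \<noteq> mball y s" by blast
  then have "card {mball x s, mball y s} = 2" by simp
  moreover have "{mball x s, mball y s} \<subseteq> P" using xy unfolding P_def by blast
  ultimately have two: "2 \<le> card P" using card_mono[OF fin] by metis
  have inside: "{u, v} \<notin> edges (threshold_graph M d r)" if "A \<in> P" "u \<in> A" "v \<in> A" for A u v
    using eq[OF that(1,2)] that(3) s(1) unfolding edge_threshold_graph_iff by auto
  have across: "{u, v} \<in> edges (threshold_graph M d r)"
    if "A \<in> P" "B \<in> P" "A \<noteq> B" "u \<in> A" "v \<in> B" for A B u v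
  proof -
    have uv: "u \<in> M" "v \<in> M" using partition_onD1[OF part] that by blast+
    have "v \<notin> A" using eq that by blast
    then show ?thesis
      using eq[OF that(1,4)] uv that(4) s(1) unfolding edge_threshold_graph_iff by auto
  qed
  have "simple_graph (threshold_graph M d r)"
    using xy(1) by (intro simple_graph_threshold_graph) auto
  moreover have "verts (threshold_graph M d r) = M" by (simp add: threshold_graph_def)
  ultimately have "complete_k_partite (card P) (threshold_graph M d r)"
    unfolding complete_k_partite_def using two part inside across
    by (intro conjI exI[of _ P]) auto
  then show ?thesis by blast
qed

text \<open>Translates adjacency into distances. The bound within a part needs
  \<open>u \<noteq> v\<close>: a point is never adjacent to itself, whatever \<open>r\<close>
  is.\<close>

lemma complete_k_partite_threshold_graphE:
  assumes "complete_k_partite k (threshold_graph M d r)"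
  obtains P where "partition_on M P" "finite P"
    "\<And>A u v. A \<in> P \<Longrightarrow> u \<in> A \<Longrightarrow> v \<in> A \<Longrightarrow> u \<noteq> v \<Longrightarrow> ereal (d u v) < r"
    "\<And>A B u v. A \<in> P \<Longrightarrow> B \<in> P \<Longrightarrow> A \<noteq> B \<Longrightarrow> u \<in> A \<Longrightarrow> v \<in> B \<Longrightarrow> r \<le> ereal (d u v)"
proof -
  have "verts (threshold_graph M d r) = M" by (simp add: threshold_graph_def)
  then obtain P where P: "2 \<le> k" "partition_on M P" "card P = k"
    "\<forall>A\<in>P. \<forall>u\<in>A. \<forall>v\<in>A. {u, v} \<notin> edges (threshold_graph M d r)"
    "\<forall>A\<in>P. \<forall>B\<in>P. A \<noteq> B \<longrightarrow> (\<forall>u\<in>A. \<forall>v\<in>B. {u, v} \<in> edges (threshold_graph M d r))"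
    using assms unfolding complete_k_partite_def by auto
  have sub: "A \<subseteq> M" if "A \<in> P" for A
    using partition_onD1[OF P(2)] that by blast
  show thesis
  proof (rule that[OF P(2)])
    \<comment> \<open>An infinite \<open>P\<close> would have \<open>card P = 0\<close>, against
      \<open>2 \<le> k\<close>.\<close>
    show "finite P" using P(1,3) by (intro card_ge_0_finite) simp
    show "ereal (d u v) < r" if "A \<in> P" "u \<in> A" "v \<in> A" "u \<noteq> v" for A u v
      using P(4) that sub[OF that(1)] unfolding edge_threshold_graph_iff not_le[symmetric] by blast
    show "r \<le> ereal (d u v)" if "A \<in> P" "B \<in> P" "A \<noteq> B" "u \<in> A" "v \<in> B" for A B u v
      using P(5) that unfolding edge_threshold_graph_iff by blast
  qed
qed

lemma ultrametric_if_complete_k_partite: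
  assumes "\<And>r. 0 < r \<Longrightarrow> r \<le> ediam M d \<Longrightarrow> \<exists>k. complete_k_partite k (threshold_graph M d r)"
  shows "ultrametric_on M d"
  unfolding ultrametric_on_def
proof (intro ballI, rule ccontr)
  fix x y z assume M: "x \<in> M" "y \<in> M" "z \<in> M"
    and "\<not> d x y \<le> max (d x z) (d z y)"
  then have lt: "d x z < d x y" "d z y < d x y" by auto
  then have pos: "0 < d x y" using nonneg[of x z] by linarith
  then have "x \<noteq> y" using M by auto
  obtain k where "complete_k_partite k (threshold_graph M d (ereal (d x y)))"
    using assms pos dist_le_ediam M by fastforce
  then obtain P where P: "partition_on M P"
    "\<And>A u v. A \<in> P \<Longrightarrow> u \<in> A \<Longrightarrow> v \<in> A \<Longrightarrow> u \<noteq> v \<Longrightarrow> d u v < d x y"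
    "\<And>A B u v. A \<in> P \<Longrightarrow> B \<in> P \<Longrightarrow> A \<noteq> B \<Longrightarrow> u \<in> A \<Longrightarrow> v \<in> B \<Longrightarrow> d x y \<le> d u v"
    by (rule complete_k_partite_threshold_graphE) auto
  \<comment> \<open>Both distances to \<open>z\<close> are below the threshold, so
    \<open>A = C = B\<close>; then \<open>x\<close> and \<open>y\<close> share a part and
    \<open>d x y < d x y\<close>.\<close>
  obtain A B C where "A \<in> P" "x \<in> A" "B \<in> P" "y \<in> B" "C \<in> P" "z \<in> C"
    using M partition_onD1[OF P(1)] by blast
  then show False using P(2,3) lt \<open>x \<noteq> y\<close> by (metis less_irrefl not_le)
qed

lemma mtotally_bounded_if_complete_k_partite:
  assumes "\<And>r. 0 < r \<Longrightarrow> r \<le> ediam M d \<Longrightarrow> \<exists>k. complete_k_partite k (threshold_graph M d r)"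
  shows "mtotally_bounded M"
  unfolding mtotally_bounded_def
proof (intro allI impI)
  fix e :: real assume e: "0 < e"
  show "\<exists>K. finite K \<and> K \<subseteq> M \<and> M \<subseteq> (\<Union>x\<in>K. mball x e)"
  proof (cases "ereal e \<le> ediam M d")
    case True
    then obtain k where "complete_k_partite k (threshold_graph M d (ereal e))"
      using assms e by fastforce
    then obtain P where P: "partition_on M P" "finite P"
      "\<And>A u v. A \<in> P \<Longrightarrow> u \<in> A \<Longrightarrow> v \<in> A \<Longrightarrow> u \<noteq> v \<Longrightarrow> d u v < e"
      by (rule complete_k_partite_threshold_graphE) auto
    obtain c where c: "\<And>A. A \<in> P \<Longrightarrow> c A \<in> A"
      using partition_onD3[OF P(1)] by (metis ex_in_conv)
    have sub: "c ` P \<subseteq> M" using c partition_onD1[OF P(1)] by blast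
    have "M \<subseteq> (\<Union>x\<in>c ` P. mball x e)"
    proof
      fix y assume y: "y \<in> M"
      then obtain A where A: "A \<in> P" "y \<in> A" using partition_onD1[OF P(1)] by blast
      have "d (c A) y < e"
        using P(3)[OF A(1) c[OF A(1)] A(2)] e y by (cases "c A = y") auto
      then show "y \<in> (\<Union>x\<in>c ` P. mball x e)" using A y sub by auto
    qed
    then show ?thesis using sub P(2) by blast
  next
    case False
    \<comment> \<open>The hypothesis says nothing about thresholds above the diameter, but there a
      single ball covers a nonempty space.\<close>
    then have small: "d x y < e" if "x \<in> M" "y \<in> M" for x y
      using dist_le_ediam[OF that] by (metis ereal_less_eq(3) not_le order_trans)
    show ?thesis
    proof (cases "M = {}")
      case True
      then show ?thesis by auto
    next
      case False
      then obtain x where "x \<in> M" by blast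
      then have "M \<subseteq> (\<Union>x\<in>{x}. mball x e)" using small by auto
      then show ?thesis using \<open>x \<in> M\<close> by (intro exI[of _ "{x}"]) auto
    qed
  qed
qed

end

theorem theorem3p14:
  fixes X :: "'a set" and d :: "'a \<Rightarrow> 'a \<Rightarrow> real"
  assumes "Metric_space X d"
    and "\<exists>x\<in>X. \<exists>y\<in>X. x \<noteq> y"
  shows "Metric_space.mtotally_bounded X d X \<and> ultrametric_on X d \<longleftrightarrow>
    (\<forall>r::ereal. 0 < r \<and> r \<le> ediam X d \<longrightarrow>
       (\<exists>k::nat. complete_k_partite k (threshold_graph X d r)))"
proof -
  interpret Metric_space X d by (fact assms(1))
  show ?thesis
    using complete_k_partite_threshold_graph ultrametric_if_complete_k_partite
      mtotally_bounded_if_complete_k_partite by blast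
qed

end
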